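(* Let $d>0$ be a squarefree integer. There exists a constant $c(d)>0$ such that $$\mathrm{I}_{\mathcal{F}_d}(z,t)\le c(d)\,D(z,t)^2\quad\text{for every }(z,t)\in\mathbb{H}^3 .$$ Moreover, the exponent $2$ is sharp (it cannot be replaced by any smaller exponent: for every $e<2$ and every $c>0$ there is a point $(z,t)\in\mathbb{H}^3$ with $\mathrm{I}_{\mathcal{F}_d}(z,t)>c\,D(z,t)^e$), and the constant can be chosen so that $c(d)\le C d$ for a universal constant $C>0$ independent of $d$.
   Context: Upper half-space model $\mathbb{H}^3=\{(z,t): z\in\mathbb{C},\ t>0\}$. The matrix $\begin{pmatrix}a&b\\c&d'\end{pmatrix}\in\mathrm{SL}(2,\mathbb{C})$ acts by $$(z,t)\mapsto\Big(\frac{(az+b)(\bar c\bar z+\bar d')+a\bar c t^2}{|cz+d'|^2+|c|^2t^2},\ \frac{t}{|cz+d'|^2+|c|^2t^2}\Big),$$ which descends to an action of $\mathrm{PSL}(2,\mathbb{C})$. For a squarefree integer $d>0$, let $K_d=\mathbb{Q}(\sqrt{-d})$ and $\mathcal{O}_d=\mathbb{Z}[\omega]$ its ring of integers, where $\omega=\frac{-1+\sqrt{-d}}{2}$ if $d\equiv 3\pmod 4$ and $\omega=\sqrt{-d}$ otherwise. The Bianchi group is $\Gamma_d=\mathrm{PSL}(2,\mathcal{O}_d)$. Let $\mathcal{B}_d=\{(z,t)\in\mathbb{H}^3: |cz+e|^2+|c|^2t^2\ge 1 \text{ for all } c,e\in\mathcal{O}_d \text{ with } \langle c,e\rangle=\mathcal{O}_d\}$.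 Let $\mathcal{P}_1=\{x+iy: |x|\le 1/2,\ 0\le y\le 1/2\}$; $\mathcal{P}_3=\{x+iy: 0\le x,\ x/\sqrt3\le y\le (1-x)/\sqrt3\}\cup\{x+iy: 0\le x\le 1/2,\ -x/\sqrt3\le y\le x/\sqrt3\}$; for $d\notin\{1,3\}$, $\mathcal{P}_d=\{x+iy:0\le x\le 1,\ 0\le y\le\sqrt d\}$ if $d\equiv1,2\pmod 4$ and $\mathcal{P}_d=\{x+iy:0\le x\le1,\ 0\le y\le \sqrt d/2\}$ if $d\equiv 3\pmod 4$. The set $\mathcal{F}_d=\{(z,t)\in\mathcal{B}_d: z\in\mathcal{P}_d\}$ (a fundamental domain for $\Gamma_d$). Height: for $x\in\mathcal{O}_d$, $\mathrm{H}(x)=|x|$; for $M\in\mathrm{SL}(2,\mathcal{O}_d)$, $\mathrm{H}(M)$ is the maximum of the heights of its entries, and for $[M]\in\Gamma_d$, $\mathrm{H}([M])=\mathrm{H}(M)$. The $\Gamma_d$-intricacy of $(z,t)$ is $\mathrm{I}_{\mathcal{F}_d}(z,t)=\min\{\mathrm{H}(\sigma):\sigma\in\Gamma_d,\ \sigma(z,t)\in\mathcal{F}_d\}$. Finally $D(z,t)=\max\{1,|z|,t^{-1}\}$. *)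

theory Defs
  imports "HOL-Analysis.Analysis" "HOL-Algebra.Coset" "HOL-Computational_Algebra.Squarefree"
begin

definition upper_half_space :: "(complex \<times> real) set" where
  "upper_half_space = {(z, t). t > 0}"

definition omega :: "nat \<Rightarrow> complex" where
  "omega d = (if d mod 4 = 3 then (-1 + \<i> * of_real (sqrt (real d))) / 2
              else \<i> * of_real (sqrt (real d)))"

text \<open>The ring \<open>\<int>[\<omega>]\<close>, which is the ring of integers of \<open>\<rat>(\<surd>-d)\<close> for squarefree \<open>d > 0\<close>.
  As \<open>\<omega>\<close> is a quadratic integer, \<open>1\<close> and \<open>\<omega>\<close> already span it over \<open>\<int>\<close>.\<close>

definition quad_ints :: "nat \<Rightarrow> complex set" where
  "quad_ints d = {of_int m + of_int n * omega d | m n :: int. True}"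

definition SL2 :: "complex set \<Rightarrow> (complex^2^2) monoid" where
  "SL2 R = \<lparr>carrier = {A. (\<forall>i j. A $ i $ j \<in> R) \<and> det A = 1},
            monoid.mult = (**), one = mat 1\<rparr>"

definition PSL2 :: "complex set \<Rightarrow> (complex^2^2) set monoid" where
  "PSL2 R = SL2 R Mod {mat 1, - mat 1}"

definition Bianchi :: "nat \<Rightarrow> (complex^2^2) set monoid" where
  "Bianchi d = PSL2 (quad_ints d)"

definition SL2_act :: "complex^2^2 \<Rightarrow> complex \<times> real \<Rightarrow> complex \<times> real" where
  "SL2_act A = (\<lambda>(z, t).
     let a = A $ 1 $ 1; b = A $ 1 $ 2; c = A $ 2 $ 1; e = A $ 2 $ 2;
         N = (cmod (c * z + e))\<^sup>2 + (cmod c)\<^sup>2 * t\<^sup>2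
     in (((a * z + b) * (cnj c * cnj z + cnj e) + a * cnj c * of_real (t\<^sup>2)) / of_real N, t / N))"

definition SL2_height :: "complex^2^2 \<Rightarrow> real" where
  "SL2_height A = Max {cmod (A $ i $ j) | i j. True}"

text \<open>An element of \<open>PSL2 R\<close> is a coset \<open>{A, -A}\<close>. Its action and its height are the common value
  on its representatives; see \<open>PSL2_act_coset\<close> and \<open>PSL2_height_coset\<close> below.\<close>

definition PSL2_act :: "(complex^2^2) set \<Rightarrow> complex \<times> real \<Rightarrow> complex \<times> real" where
  "PSL2_act \<sigma> p = the_elem ((\<lambda>A. SL2_act A p) ` \<sigma>)"

definition PSL2_height :: "(complex^2^2) set \<Rightarrow> real" where
  "PSL2_height \<sigma> = the_elem (SL2_height ` \<sigma>)"

definition floor_region :: "nat \<Rightarrow> (complex \<times> real) set" where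
  "floor_region d = {(z, t) \<in> upper_half_space.
     \<forall>c\<in>quad_ints d. \<forall>e\<in>quad_ints d.
       {x * c + y * e | x y. x \<in> quad_ints d \<and> y \<in> quad_ints d} = quad_ints d \<longrightarrow>
       (cmod (c * z + e))\<^sup>2 + (cmod c)\<^sup>2 * t\<^sup>2 \<ge> 1}"

text \<open>The last case is \<open>d \<equiv> 1, 2 (mod 4)\<close>, since \<open>4\<close> does not divide a squarefree \<open>d\<close>.\<close>

definition cusp_polygon :: "nat \<Rightarrow> complex set" where
  "cusp_polygon d =
    (if d = 1 then {z. \<bar>Re z\<bar> \<le> 1 / 2 \<and> 0 \<le> Im z \<and> Im z \<le> 1 / 2}
     else if d = 3 then
       {z. 0 \<le> Re z \<and> Re z / sqrt 3 \<le> Im z \<and> Im z \<le> (1 - Re z) / sqrt 3} \<union>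
       {z. 0 \<le> Re z \<and> Re z \<le> 1 / 2 \<and> - Re z / sqrt 3 \<le> Im z \<and> Im z \<le> Re z / sqrt 3}
     else if d mod 4 = 3 then
       {z. 0 \<le> Re z \<and> Re z \<le> 1 \<and> 0 \<le> Im z \<and> Im z \<le> sqrt (real d) / 2}
     else {z. 0 \<le> Re z \<and> Re z \<le> 1 \<and> 0 \<le> Im z \<and> Im z \<le> sqrt (real d)})"

definition fund_domain :: "nat \<Rightarrow> (complex \<times> real) set" where
  "fund_domain d = {(z, t) \<in> floor_region d. z \<in> cusp_polygon d}"

text \<open>\<open>LEAST\<close> asserts an attained minimum: nothing can be derived about the intricacy of \<open>p\<close>
  without showing that the minimum exists.\<close>

definition intricacy :: "nat \<Rightarrow> complex \<times> real \<Rightarrow> real" where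
  "intricacy d p = (LEAST h. h \<in> {PSL2_height \<sigma> | \<sigma>.
     \<sigma> \<in> carrier (Bianchi d) \<and> PSL2_act \<sigma> p \<in> fund_domain d})"

definition depth :: "complex \<times> real \<Rightarrow> real" where
  "depth = (\<lambda>(z, t). Max {1, cmod z, inverse t})"

lemma carrier_PSL2: "carrier (PSL2 R) = (\<lambda>A. {A, - A}) ` carrier (SL2 R)"
proof -
  have neg: "- mat 1 ** A = - A" for A :: "complex^2^2"
    by (simp add: vec_eq_iff matrix_matrix_mult_def mat_def UNIV_2 forall_2)
  show ?thesis
    by (auto simp: PSL2_def FactGroup_def RCOSETS_def r_coset_def SL2_def neg)
qed

lemma SL2_act_uminus: "SL2_act (- A) p = SL2_act A p"
proof -
  have n: "cmod (- x - y) = cmod (x + y)" for x y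
    by (metis minus_add_distrib norm_minus_cancel uminus_add_conv_diff add.commute)
  show ?thesis
    by (cases p) (simp add: SL2_act_def Let_def n algebra_simps)
qed

lemma SL2_height_uminus: "SL2_height (- A) = SL2_height A"
  by (simp add: SL2_height_def)

lemma PSL2_act_coset: "PSL2_act {A, - A} p = SL2_act A p"
  by (simp add: PSL2_act_def SL2_act_uminus)

lemma PSL2_height_coset: "PSL2_height {A, - A} = SL2_height A"
  by (simp add: PSL2_height_def SL2_height_uminus)

end

theory Submission
  imports Defs "HOL-Real_Asymp.Real_Asymp"
begin

text \<open>Among the unimodular rows \<open>(c, e)\<close>, one minimizing \<open>|c z + e|\<^sup>2 + |c|\<^sup>2 t\<^sup>2\<close> is the bottom row of
  matrices taking \<open>(z, t)\<close> into the floor region; a unit rotation and a translation then move the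
  point over the cusp polygon without changing this quantity, whose minimum is at most \<open>1\<close>. With
  \<open>D\<close> the depth of \<open>(z, t)\<close>, this forces \<open>|c| \<le> D\<close> and \<open>|e| \<le> 2 D\<^sup>2\<close>, and as the image has
  complex coordinate \<open>O(\<surd>d)\<close>, also \<open>|a| = O(\<surd>d D)\<close> and \<open>|b| = O(\<surd>d D\<^sup>2)\<close>.

  For sharpness, take the preimage of \<open>(0, n)\<close> under the matrix \<open>(n, n\<^sup>2 - 1; 1, n)\<close>. Its depth is at most
  \<open>2 n\<close>, while every reducing matrix is an upper triangular one with bounded entries times the
  given one, so that its upper right entry is of order \<open>n\<^sup>2\<close>.\<close>

subsection \<open>Rings of integers of imaginary quadratic fields\<close>

lemma quad_ints_of_int [simp]: "of_int m \<in> quad_ints d"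
  unfolding quad_ints_def by (rule CollectI, rule exI[of _ m], rule exI[of _ 0]) simp

lemma quad_ints_0 [simp]: "0 \<in> quad_ints d"
  using quad_ints_of_int[of 0] by simp

lemma quad_ints_1 [simp]: "1 \<in> quad_ints d"
  using quad_ints_of_int[of 1] by simp

lemma quad_ints_of_nat [simp]: "of_nat n \<in> quad_ints d"
  using quad_ints_of_int[of "int n"] by simp

lemma quad_ints_omega [simp]: "omega d \<in> quad_ints d"
  unfolding quad_ints_def by (rule CollectI, rule exI[of _ 0], rule exI[of _ 1]) simp

lemma quad_ints_add [intro]:
  assumes "x \<in> quad_ints d" "y \<in> quad_ints d" shows "x + y \<in> quad_ints d"
proof -
  obtain m n m' n' where "x = of_int m + of_int n * omega d" "y = of_int m' + of_int n' * omega d"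
    using assms unfolding quad_ints_def by blast
  then have "x + y = of_int (m + m') + of_int (n + n') * omega d" by (simp add: algebra_simps)
  then show ?thesis unfolding quad_ints_def by blast
qed

lemma quad_ints_uminus [intro]:
  assumes "x \<in> quad_ints d" shows "- x \<in> quad_ints d"
proof -
  obtain m n where "x = of_int m + of_int n * omega d"
    using assms unfolding quad_ints_def by blast
  then have "- x = of_int (- m) + of_int (- n) * omega d" by (simp add: algebra_simps)
  then show ?thesis unfolding quad_ints_def by blast
qed

lemma quad_ints_diff [intro]:
  "x \<in> quad_ints d \<Longrightarrow> y \<in> quad_ints d \<Longrightarrow> x - y \<in> quad_ints d"
  using quad_ints_add[of x d "- y"] by auto

lemma omega_square:
  "(omega d)\<^sup>2 = (if d mod 4 = 3 then - of_int ((1 + int d) div 4) - omega d else - of_nat d)"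
proof (cases "d mod 4 = 3")
  case True
  then have "4 * ((1 + int d) div 4) = 1 + int d" by presburger
  then have q: "4 * of_int ((1 + int d) div 4) = 1 + (of_nat d :: complex)"
    by (metis of_int_1 of_int_add of_int_mult of_int_numeral of_int_of_nat_eq)
  define u where "u = \<i> * complex_of_real (sqrt (real d))"
  have "u\<^sup>2 = - of_nat d" by (simp add: u_def power_mult_distrib flip: of_real_power)
  moreover have u: "u = 1 + 2 * omega d" using True by (simp add: omega_def u_def diff_divide_distrib)
  ultimately have "(1 + 2 * omega d)\<^sup>2 = - of_nat d" by simp
  then have "4 * (omega d)\<^sup>2 = - (1 + of_nat d) - 4 * omega d" by algebra
  also have "\<dots> = 4 * (- of_int ((1 + int d) div 4) - omega d)"
    using q by simp
  finally have "4 * (omega d)\<^sup>2 = 4 * (- of_int ((1 + int d) div 4) - omega d)" .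
  then have "(omega d)\<^sup>2 = - of_int ((1 + int d) div 4) - omega d"
    by (subst (asm) mult_cancel_left) simp
  then show ?thesis using True by simp
next
  case False
  then show ?thesis by (simp add: omega_def power_mult_distrib flip: of_real_power)
qed

lemma quad_ints_mult [intro]:
  assumes "x \<in> quad_ints d" "y \<in> quad_ints d" shows "x * y \<in> quad_ints d"
proof -
  have sq: "(omega d)\<^sup>2 \<in> quad_ints d" unfolding omega_square
    by (simp add: quad_ints_diff quad_ints_uminus)
  have smult: "of_int k * x \<in> quad_ints d" if x: "x \<in> quad_ints d" for k x
  proof -
    obtain m n where "x = of_int m + of_int n * omega d"
      using x unfolding quad_ints_def by blast
    then have "of_int k * x = of_int (k * m) + of_int (k * n) * omega d" by (simp add: algebra_simps)
    then show ?thesis unfolding quad_ints_def by blast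
  qed
  obtain m n m' n' where "x = of_int m + of_int n * omega d" "y = of_int m' + of_int n' * omega d"
    using assms unfolding quad_ints_def by blast
  then have "x * y = of_int (m * m') + of_int (m * n' + n * m') * omega d
      + of_int (n * n') * (omega d)\<^sup>2"
    by (simp add: algebra_simps power2_eq_square)
  also have "\<dots> \<in> quad_ints d" by (intro quad_ints_add smult sq quad_ints_of_int quad_ints_omega)
  finally show ?thesis .
qed

lemma quad_ints_cnj [intro]:
  assumes "x \<in> quad_ints d" shows "cnj x \<in> quad_ints d"
proof -
  have "cnj (omega d) = (if d mod 4 = 3 then - (1 + omega d) else - omega d)"
    by (simp add: omega_def complex_eq_iff)
  then have "cnj (omega d) \<in> quad_ints d"
    using quad_ints_uminus[OF quad_ints_add[OF quad_ints_1 quad_ints_omega]]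
      quad_ints_uminus[OF quad_ints_omega] by presburger
  moreover obtain m n where "x = of_int m + of_int n * omega d"
    using assms unfolding quad_ints_def by blast
  ultimately show ?thesis by (simp add: quad_ints_add quad_ints_mult)
qed

lemma cmod_square_Nats:
  assumes "x \<in> quad_ints d" shows "(cmod x)\<^sup>2 \<in> \<nat>"
proof -
  obtain m n where x: "x = of_int m + of_int n * omega d"
    using assms unfolding quad_ints_def by blast
  have "(cmod x)\<^sup>2 \<in> \<int>"
  proof (cases "d mod 4 = 3")
    case True
    then have "4 * ((1 + int d) div 4) = 1 + int d" by presburger
    then have "4 * of_int ((1 + int d) div 4) = 1 + real d"
      by (metis of_int_1 of_int_add of_int_mult of_int_numeral of_int_of_nat_eq)
    moreover have ReIm: "Re x = of_int m - of_int n / 2" "Im x = of_int n * sqrt (real d) / 2"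
      using True by (simp_all add: x omega_def)
    have "4 * (cmod x)\<^sup>2 = 4 * of_int m ^ 2 - 4 * of_int m * of_int n + of_int n ^ 2 * (1 + real d)"
      unfolding cmod_power2 ReIm by (simp add: power2_eq_square algebra_simps)
    ultimately have "4 * (cmod x)\<^sup>2 = 4 * (of_int m ^ 2 - of_int m * of_int n
        + of_int n ^ 2 * of_int ((1 + int d) div 4))"
      by (metis (no_types, opaque_lifting) mult.assoc mult.left_commute right_diff_distrib distrib_left)
    then have "(cmod x)\<^sup>2 = of_int (m\<^sup>2 - m * n + n\<^sup>2 * ((1 + int d) div 4))"
      by simp
    then show ?thesis by (metis Ints_of_int)
  next
    case False
    then have "(cmod x)\<^sup>2 = of_int (m\<^sup>2 + n\<^sup>2 * int d)"
      by (simp add: x omega_def cmod_power2 power_mult_distrib)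
    then show ?thesis by (metis Ints_of_int)
  qed
  then show ?thesis by (simp add: Nats_altdef2)
qed

lemma cmod_ge_1:
  assumes "x \<in> quad_ints d" "x \<noteq> 0" shows "cmod x \<ge> 1"
proof -
  obtain n where n: "(cmod x)\<^sup>2 = real n" using cmod_square_Nats[OF assms(1)] by (metis Nats_cases)
  then have "n \<noteq> 0" using assms(2) by (auto intro!: Nat.gr0I)
  then have "(cmod x)\<^sup>2 \<ge> 1\<^sup>2" using n by simp
  then show ?thesis by (metis power2_le_imp_le norm_ge_zero)
qed

lemma cmod_unit:
  assumes "x \<in> quad_ints d" "y \<in> quad_ints d" "x * y = 1"
  shows "cmod x = 1" "cmod y = 1"
proof -
  have "x \<noteq> 0" "y \<noteq> 0" using assms(3) by auto
  then have ge: "cmod x \<ge> 1" "cmod y \<ge> 1" using assms cmod_ge_1 by auto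
  have m: "cmod x * cmod y = 1" using assms(3) by (metis norm_mult norm_one)
  have "cmod x * 1 \<le> cmod x * cmod y" "1 * cmod y \<le> cmod x * cmod y"
    using ge by (simp_all add: mult_le_cancel_left1 mult_le_cancel_right1)
  then show "cmod x = 1" "cmod y = 1" using m ge by auto
qed

lemma finite_quad_ints_cball:
  assumes "d > 0" shows "finite {x \<in> quad_ints d. cmod x \<le> R}"
proof -
  define h where "h = Im (omega d)"
  have h: "h > 0" using assms by (simp add: h_def omega_def)
  define K where "K = \<lceil>R / h\<rceil>"
  define L where "L = \<lceil>R + of_int K * cmod (omega d)\<rceil>"
  have "{x \<in> quad_ints d. cmod x \<le> R} \<subseteq>
    (\<lambda>(m, n). of_int m + of_int n * omega d) ` ({-L..L} \<times> {-K..K})"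
  proof
    fix x assume x: "x \<in> {x \<in> quad_ints d. cmod x \<le> R}"
    then obtain m n where xe: "x = of_int m + of_int n * omega d"
      unfolding quad_ints_def by blast
    have "\<bar>of_int n\<bar> * h = \<bar>Im x\<bar>" using h by (simp add: xe h_def abs_mult)
    also have "\<dots> \<le> R" using x abs_Im_le_cmod[of x] by simp
    finally have "\<bar>real_of_int n\<bar> \<le> R / h" using h by (simp add: field_simps)
    then have n: "\<bar>n\<bar> \<le> K" unfolding K_def by linarith
    have "cmod (of_int m) = cmod (x - of_int n * omega d)" by (simp add: xe)
    also have "\<dots> \<le> cmod x + \<bar>of_int n\<bar> * cmod (omega d)"
      using norm_triangle_ineq4[of x "of_int n * omega d"] by (simp add: norm_mult)
    also have "\<dots> \<le> R + of_int K * cmod (omega d)"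
      using x n by (intro add_mono mult_right_mono) auto
    finally have "\<bar>m\<bar> \<le> L" unfolding L_def by (simp) linarith
    then show "x \<in> (\<lambda>(m, n). of_int m + of_int n * omega d) ` ({-L..L} \<times> {-K..K})"
      using n xe by (intro image_eqI[of _ _ "(m, n)"]) auto
  qed
  then show ?thesis by (rule finite_subset) auto
qed

subsection \<open>The action on the upper half-space\<close>

definition row_norm :: "complex \<Rightarrow> complex \<Rightarrow> complex \<times> real \<Rightarrow> real" where
  "row_norm c e = (\<lambda>(z, t). (cmod (c * z + e))\<^sup>2 + (cmod c)\<^sup>2 * t\<^sup>2)"

definition act_num :: "complex^2^2 \<Rightarrow> complex \<times> real \<Rightarrow> complex" where
  "act_num A = (\<lambda>(z, t). (A $ 1 $ 1 * z + A $ 1 $ 2) * cnj (A $ 2 $ 1 * z + A $ 2 $ 2)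
     + A $ 1 $ 1 * cnj (A $ 2 $ 1) * of_real (t\<^sup>2))"

abbreviation act_den :: "complex^2^2 \<Rightarrow> complex \<times> real \<Rightarrow> real" where
  "act_den A \<equiv> row_norm (A $ 2 $ 1) (A $ 2 $ 2)"

lemma SL2_act_eq: "SL2_act A p = (act_num A p / of_real (act_den A p), snd p / act_den A p)"
  by (cases p) (simp add: SL2_act_def act_num_def row_norm_def Let_def)

lemma of_real_row_norm:
  "complex_of_real (row_norm c e (z, t)) =
     (c * z + e) * (cnj c * cnj z + cnj e) + c * cnj c * (of_real t)\<^sup>2"
  by (simp add: row_norm_def complex_norm_square of_real_power[symmetric] del: of_real_power)

lemma row_norm_nonneg: "row_norm c e p \<ge> 0"
  by (cases p) (simp add: row_norm_def)

lemma act_den_pos: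
  assumes "det A = 1" "t > 0"
  shows "act_den A (z, t) > 0"
proof (rule ccontr)
  assume "\<not> ?thesis"
  then have "row_norm (A $ 2 $ 1) (A $ 2 $ 2) (z, t) = 0"
    using row_norm_nonneg by (metis less_eq_real_def)
  then have "A $ 2 $ 1 = 0" "A $ 2 $ 2 = 0"
    using \<open>t > 0\<close> by (auto simp: row_norm_def add_nonneg_eq_0_iff)
  then show False using assms(1) by (simp add: det_2)
qed

lemma act_point_norm:
  fixes a b c e z :: complex and t :: real
  assumes "a * e - b * c = 1"
  defines "X \<equiv> (a * z + b) * (cnj c * cnj z + cnj e) + a * cnj c * (of_real t)\<^sup>2"
  defines "M \<equiv> (a * z + b) * (cnj a * cnj z + cnj b) + a * cnj a * (of_real t)\<^sup>2"
  defines "N \<equiv> (c * z + e) * (cnj c * cnj z + cnj e) + c * cnj c * (of_real t)\<^sup>2"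
  shows "X * cnj X + (of_real t)\<^sup>2 = M * N"
proof -
  have conj_det: "cnj a * cnj e - cnj b * cnj c = 1"
    using arg_cong[OF assms(1), of cnj] by simp
  have "M * N - X * cnj X = (of_real t)\<^sup>2 * ((a * e - b * c) * (cnj a * cnj e - cnj b * cnj c))"
    unfolding X_def M_def N_def by (simp add: algebra_simps power2_eq_square)
  then show ?thesis using assms(1) conj_det by (simp add: algebra_simps)
qed

lemma act_scaled:
  fixes B :: "complex^2^2" and c e c' e' z :: complex and t :: real
  assumes "det B = 1" "t > 0"
  defines "X \<equiv> act_num B (z, t)" and "N \<equiv> complex_of_real (act_den B (z, t))"
  shows "((c * (X / N) + e) * cnj (c' * (X / N) + e') + c * cnj c' * (of_real t / N)\<^sup>2) * N =
     ((c * B$1$1 + e * B$2$1) * z + (c * B$1$2 + e * B$2$2)) *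
      cnj ((c' * B$1$1 + e' * B$2$1) * z + (c' * B$1$2 + e' * B$2$2)) +
     (c * B$1$1 + e * B$2$1) * cnj (c' * B$1$1 + e' * B$2$1) * (of_real t)\<^sup>2" (is "?l * N = ?r")
proof -
  define M where "M = (B$1$1 * z + B$1$2) * (cnj (B$1$1) * cnj z + cnj (B$1$2))
    + B$1$1 * cnj (B$1$1) * (of_real t)\<^sup>2"
  have N0: "N \<noteq> 0" and cN: "cnj N = N" using act_den_pos[OF assms(1,2)] unfolding N_def
    by (auto simp: less_le)
  have MN: "X * cnj X + (of_real t)\<^sup>2 = M * N"
    using act_point_norm[of "B$1$1" "B$2$2" "B$1$2" "B$2$1" z t] assms(1)
    unfolding X_def N_def M_def act_num_def of_real_row_norm by (simp add: det_2)
  have "?l * N * N = (c * X + e * N) * cnj (c' * X + e' * N) + c * cnj c' * (of_real t)\<^sup>2"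
    using N0 cN by (simp add: field_simps power2_eq_square)
  also have "\<dots> = c * cnj c' * (X * cnj X + (of_real t)\<^sup>2) + (c * cnj e' * X + e * cnj c' * cnj X + e * cnj e' * N) * N"
    using cN by (simp add: algebra_simps)
  also have "\<dots> = (c * cnj c' * M + c * cnj e' * X + e * cnj c' * cnj X + e * cnj e' * N) * N"
    unfolding MN by (simp add: algebra_simps)
  also have "c * cnj c' * M + c * cnj e' * X + e * cnj c' * cnj X + e * cnj e' * N = ?r"
    unfolding X_def N_def M_def act_num_def of_real_row_norm
    by (simp add: algebra_simps power2_eq_square)
  finally show ?thesis using N0 by simp
qed

lemma row_norm_SL2_act:
  assumes "det B = 1" "t > 0"
  shows "row_norm c e (SL2_act B (z, t)) * act_den B (z, t) =
    row_norm (c * B$1$1 + e * B$2$1) (c * B$1$2 + e * B$2$2) (z, t)"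
proof -
  have "complex_of_real (row_norm c e (SL2_act B (z, t)) * act_den B (z, t)) =
    complex_of_real (row_norm (c * B$1$1 + e * B$2$1) (c * B$1$2 + e * B$2$2) (z, t))"
    using act_scaled[OF assms, of c z e c e]
    unfolding of_real_mult SL2_act_eq of_real_row_norm snd_conv of_real_divide
    by simp
  then show ?thesis using of_real_eq_iff by blast
qed

lemma act_num_SL2_act:
  assumes "det B = 1" "t > 0"
  shows "act_num A (SL2_act B (z, t)) * of_real (act_den B (z, t)) = act_num (A ** B) (z, t)"
  using act_scaled[OF assms, of "A$1$1" z "A$1$2" "A$2$1" "A$2$2"]
  by (simp add: SL2_act_eq act_num_def matrix_matrix_mult_def sum_2)

lemma SL2_act_mult:
  assumes "det B = 1" "t > 0"
  shows "SL2_act (A ** B) (z, t) = SL2_act A (SL2_act B (z, t))"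
proof -
  have den: "act_den (A ** B) (z, t) = act_den A (SL2_act B (z, t)) * act_den B (z, t)"
    by (simp add: row_norm_SL2_act[OF assms] matrix_matrix_mult_def sum_2)
  show ?thesis
    unfolding SL2_act_eq[of "A ** B"] SL2_act_eq[of A]
    using act_den_pos[OF assms, of z]
    by (simp add: den act_num_SL2_act[OF assms, symmetric] SL2_act_eq[of B])
qed

subsection \<open>The floor region and the height bound\<close>

definition mat2 :: "complex \<Rightarrow> complex \<Rightarrow> complex \<Rightarrow> complex \<Rightarrow> complex^2^2" where
  "mat2 a b c e = vector [vector [a, b], vector [c, e]]"

lemma mat2_nth [simp]:
  "mat2 a b c e $ 1 $ 1 = a" "mat2 a b c e $ 1 $ 2 = b"
  "mat2 a b c e $ 2 $ 1 = c" "mat2 a b c e $ 2 $ 2 = e"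
  by (simp_all add: mat2_def)

lemma det_mat2 [simp]: "det (mat2 a b c e) = a * e - b * c"
  by (simp add: det_2)

lemma matrix_mult_nth_2:
  fixes A B :: "complex^2^2"
  shows "(A ** B) $ i $ j = A $ i $ 1 * B $ 1 $ j + A $ i $ 2 * B $ 2 $ j"
  by (simp add: matrix_matrix_mult_def sum_2)

lemma carrier_SL2_iff: "A \<in> carrier (SL2 R) \<longleftrightarrow> (\<forall>i j. A $ i $ j \<in> R) \<and> det A = 1"
  by (simp add: SL2_def)

lemma mat2_carrier_SL2:
  "\<lbrakk>a \<in> R; b \<in> R; c \<in> R; e \<in> R; a * e - b * c = 1\<rbrakk> \<Longrightarrow> mat2 a b c e \<in> carrier (SL2 R)"
  by (simp add: carrier_SL2_iff forall_2)

lemma SL2_mult_closed: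
  assumes "A \<in> carrier (SL2 (quad_ints d))" "B \<in> carrier (SL2 (quad_ints d))"
  shows "A ** B \<in> carrier (SL2 (quad_ints d))"
  using assms by (simp add: carrier_SL2_iff matrix_mult_nth_2 det_mul quad_ints_add quad_ints_mult)

definition unimodular_row :: "nat \<Rightarrow> complex \<Rightarrow> complex \<Rightarrow> bool" where
  "unimodular_row d c e \<longleftrightarrow> c \<in> quad_ints d \<and> e \<in> quad_ints d \<and>
     (\<exists>x\<in>quad_ints d. \<exists>y\<in>quad_ints d. x * c + y * e = 1)"

lemma floor_region_iff:
  "p \<in> floor_region d \<longleftrightarrow> snd p > 0 \<and> (\<forall>c e. unimodular_row d c e \<longrightarrow> row_norm c e p \<ge> 1)"
proof -
  have ideal: "{x * c + y * e | x y. x \<in> quad_ints d \<and> y \<in> quad_ints d} = quad_ints d \<longleftrightarrow>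
    (\<exists>x\<in>quad_ints d. \<exists>y\<in>quad_ints d. x * c + y * e = 1)" (is "?I = _ \<longleftrightarrow> ?u")
    if ce: "c \<in> quad_ints d" "e \<in> quad_ints d" for c e
  proof
    assume "?I = quad_ints d"
    then have "1 \<in> ?I" by simp
    then show ?u by force
  next
    assume ?u
    then obtain x y where xy: "x \<in> quad_ints d" "y \<in> quad_ints d" "x * c + y * e = 1" by blast
    show "?I = quad_ints d"
    proof
      show "?I \<subseteq> quad_ints d" using ce by auto
      show "quad_ints d \<subseteq> ?I"
      proof
        fix w assume w: "w \<in> quad_ints d"
        have "w = w * (x * c + y * e)" using xy by simp
        also have "\<dots> = (w * x) * c + (w * y) * e" by (simp add: algebra_simps)
        finally show "w \<in> ?I" using w xy by blast
      qed
    qed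
  qed
  obtain z t where p: "p = (z, t)" by fastforce
  show ?thesis
    unfolding p floor_region_def upper_half_space_def unimodular_row_def row_norm_def
    using ideal by (simp cong: ball_cong conj_cong) blast
qed

lemma unimodular_row_mult:
  assumes "unimodular_row d c e" "B \<in> carrier (SL2 (quad_ints d))"
  shows "unimodular_row d (c * B$1$1 + e * B$2$1) (c * B$1$2 + e * B$2$2)"
proof -
  obtain x y where xy: "x \<in> quad_ints d" "y \<in> quad_ints d" "x * c + y * e = 1"
    using assms(1) unfolding unimodular_row_def by blast
  let ?x = "B$2$2 * x - B$1$2 * y" and ?y = "B$1$1 * y - B$2$1 * x"
  have "?x * (c * B$1$1 + e * B$2$1) + ?y * (c * B$1$2 + e * B$2$2) = det B * (x * c + y * e)"
    by (simp add: det_2 algebra_simps)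
  also have "\<dots> = 1" using xy assms(2) by (simp add: carrier_SL2_iff)
  finally have "?x * (c * B$1$1 + e * B$2$1) + ?y * (c * B$1$2 + e * B$2$2) = 1" .
  moreover have "?x \<in> quad_ints d" "?y \<in> quad_ints d"
    using assms(2) xy by (auto simp: carrier_SL2_iff)
  ultimately show ?thesis
    using assms unfolding unimodular_row_def carrier_SL2_iff
    by (meson quad_ints_add quad_ints_mult)
qed

lemma unimodular_row_completion:
  assumes "unimodular_row d c e"
  obtains A where "A \<in> carrier (SL2 (quad_ints d))" "A $ 2 $ 1 = c" "A $ 2 $ 2 = e"
proof -
  obtain x y where xy: "x \<in> quad_ints d" "y \<in> quad_ints d" "x * c + y * e = 1"
    using assms unfolding unimodular_row_def by blast
  have "mat2 y (- x) c e \<in> carrier (SL2 (quad_ints d))"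
    using assms xy by (intro mat2_carrier_SL2) (auto simp: unimodular_row_def algebra_simps)
  then show thesis using that by simp
qed

lemma row_norm_le_1_bounds:
  assumes "row_norm c e (z, t) \<le> 1" "t > 0"
  shows "cmod c \<le> inverse t" "cmod e \<le> 1 + inverse t * cmod z"
proof -
  have n: "(cmod (c * z + e))\<^sup>2 + (cmod c * t)\<^sup>2 \<le> 1"
    using assms(1) by (simp add: row_norm_def power_mult_distrib)
  then have "(cmod c * t)\<^sup>2 \<le> 1" using zero_le_power2[of "cmod (c * z + e)"] by linarith
  then have "cmod c * t \<le> 1" using assms(2) by (simp add: power_le_one_iff)
  then show c: "cmod c \<le> inverse t" using assms(2) by (simp add: field_simps)
  have "(cmod (c * z + e))\<^sup>2 \<le> 1" using n zero_le_power2[of "cmod c * t"] by linarith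
  then have "cmod (c * z + e) \<le> 1" by (simp add: power_le_one_iff)
  moreover have "cmod e \<le> cmod (c * z + e) + cmod c * cmod z"
    using norm_triangle_ineq4[of "c * z + e" "c * z"] by (simp add: norm_mult)
  ultimately show "cmod e \<le> 1 + inverse t * cmod z"
    using mult_right_mono[OF c, of "cmod z"] by simp
qed

lemma exists_minimal_row:
  assumes "d > 0" "t > 0"
  obtains c e where "unimodular_row d c e" "row_norm c e (z, t) \<le> 1"
    "\<And>c' e'. unimodular_row d c' e' \<Longrightarrow> row_norm c e (z, t) \<le> row_norm c' e' (z, t)"
proof -
  define S where "S = {(c, e). unimodular_row d c e \<and> row_norm c e (z, t) \<le> 1}"
  define f where "f = (\<lambda>(c, e). row_norm c e (z, t))"
  have "S \<subseteq> {x \<in> quad_ints d. cmod x \<le> inverse t} \<times>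
      {x \<in> quad_ints d. cmod x \<le> 1 + inverse t * cmod z}"
    using row_norm_le_1_bounds[OF _ assms(2)] by (auto simp: S_def unimodular_row_def)
  then have "finite S"
    by (rule finite_subset) (simp add: finite_quad_ints_cball[OF assms(1)])
  have "unimodular_row d 0 1"
    unfolding unimodular_row_def by (intro conjI bexI[of _ 0] bexI[of _ 1]) auto
  then have "(0, 1) \<in> S" by (simp add: S_def row_norm_def)
  then obtain s where s: "s \<in> S" "\<And>s'. s' \<in> S \<Longrightarrow> f s \<le> f s'"
    using arg_min_if_finite(1)[of S f] arg_min_least[of S _ f] \<open>finite S\<close> by blast
  obtain c e where ce: "s = (c, e)" by fastforce
  have "row_norm c e (z, t) \<le> row_norm c' e' (z, t)" if "unimodular_row d c' e'" for c' e'
  proof (cases "row_norm c' e' (z, t) \<le> 1")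
    case True
    then have "(c', e') \<in> S" using that by (simp add: S_def)
    then show ?thesis using s(2) unfolding f_def ce by fastforce
  next
    case False
    then show ?thesis using s(1) by (simp add: S_def ce)
  qed
  then show thesis using that s(1) by (auto simp: S_def ce)
qed

lemma SL2_act_in_floor_region:
  assumes A: "A \<in> carrier (SL2 (quad_ints d))" and "t > 0"
    and min: "\<And>c e. unimodular_row d c e \<Longrightarrow> act_den A (z, t) \<le> row_norm c e (z, t)"
  shows "SL2_act A (z, t) \<in> floor_region d"
proof -
  have det: "det A = 1" using A by (simp add: carrier_SL2_iff)
  have pos: "act_den A (z, t) > 0" by (rule act_den_pos[OF det \<open>t > 0\<close>])
  have "row_norm c e (SL2_act A (z, t)) \<ge> 1" if "unimodular_row d c e" for c e
  proof -
    have "act_den A (z, t) \<le> row_norm c e (SL2_act A (z, t)) * act_den A (z, t)"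
      unfolding row_norm_SL2_act[OF det \<open>t > 0\<close>] by (rule min[OF unimodular_row_mult[OF that A]])
    then show ?thesis using pos by simp
  qed
  moreover have "snd (SL2_act A (z, t)) > 0" using pos \<open>t > 0\<close> by (simp add: SL2_act_eq)
  ultimately show ?thesis by (simp add: floor_region_iff)
qed

lemma height_le_iff: "SL2_height A \<le> r \<longleftrightarrow> (\<forall>i j. cmod (A $ i $ j) \<le> r)"
proof -
  have "{cmod (A $ i $ j) | i j. True} = (\<lambda>(i, j). cmod (A $ i $ j)) ` UNIV" by auto
  then have "finite {cmod (A $ i $ j) | i j. True}" by simp
  then show ?thesis unfolding SL2_height_def by (subst Max_le_iff) auto
qed

lemma depth_ge: "depth (z, t) \<ge> 1" "depth (z, t) \<ge> cmod z" "depth (z, t) \<ge> inverse t"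
  by (simp_all add: depth_def)

text \<open>Since \<open>det A = 1\<close>, the image point \<open>z'\<close> satisfies \<open>a = c z' + cnj (c z + e) / N\<close>,
  which bounds \<open>a\<close>, and then \<open>b = (a e - 1) / c\<close>.\<close>

lemma height_bound:
  assumes A: "A \<in> carrier (SL2 (quad_ints d))" and t: "t > 0"
    and den: "act_den A (z, t) \<le> 1" and R: "cmod (fst (SL2_act A (z, t))) \<le> R"
  shows "SL2_height A \<le> (2 * R + 3) * (depth (z, t))\<^sup>2"
proof -
  define D where "D = depth (z, t)"
  have D: "D \<ge> 1" "D \<ge> cmod z" "D \<ge> inverse t" using depth_ge unfolding D_def by blast+
  have R0: "R \<ge> 0" using R norm_ge_zero by (rule order_trans[rotated])
  have DD: "D \<le> D\<^sup>2" using D by (simp add: self_le_power)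
  have RD: "R * D \<le> R * D\<^sup>2" using DD R0 by (rule mult_left_mono)
  have RD1: "R \<le> R * D" using D R0 by (simp add: mult_le_cancel_left1)
  have RD0: "R * D\<^sup>2 \<ge> 0" using R0 by simp
  define a b c e where "a = A$1$1" "b = A$1$2" "c = A$2$1" "e = A$2$2"
  note abce = this
  have O: "a \<in> quad_ints d" "b \<in> quad_ints d" "c \<in> quad_ints d" "e \<in> quad_ints d"
    and det: "a * e - b * c = 1"
    using A by (simp_all add: abce carrier_SL2_iff det_2)
  define N where "N = row_norm c e (z, t)"
  define w where "w = c * z + e"
  have N: "N = (cmod w)\<^sup>2 + (cmod c)\<^sup>2 * t\<^sup>2" "N \<le> 1" "N > 0"
    using den act_den_pos[OF _ t, of A z] A
    by (simp_all add: N_def w_def row_norm_def abce carrier_SL2_iff)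
  define X where "X = act_num A (z, t)"
  have X: "cmod X \<le> R * N"
    using R N(3) by (simp add: SL2_act_eq X_def[symmetric] N_def[symmetric] abce[symmetric] norm_divide field_simps)
  have Xe: "X = (a * z + b) * cnj w + a * cnj c * (of_real t)\<^sup>2"
    by (simp add: X_def act_num_def abce w_def)
  have cD: "cmod c \<le> D" using row_norm_le_1_bounds(1)[OF _ t] N(2) D(3) unfolding N_def by fastforce
  have "cmod e \<le> 1 + inverse t * cmod z"
    using row_norm_le_1_bounds(2)[OF _ t] N(2) unfolding N_def by blast
  also have "\<dots> \<le> 1 + D * D" using D by (intro add_left_mono mult_mono) auto
  also have "\<dots> \<le> 2 * D\<^sup>2" using DD D(1) unfolding power2_eq_square by linarith
  finally have eD: "cmod e \<le> 2 * D\<^sup>2" .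
  have "cmod a \<le> R * D + D \<and> cmod b \<le> (2 * R + 3) * D\<^sup>2"
  proof (cases "c = 0")
    case True
    then have u: "cmod a = 1" "cmod e = 1" using cmod_unit[OF O(1,4)] det by auto
    have "N = 1" using N True u by (simp add: w_def)
    moreover have "cmod X = cmod (a * z + b)" using True u by (simp add: Xe w_def norm_mult)
    ultimately have "cmod (a * z + b) \<le> R" using X by simp
    moreover have "cmod b \<le> cmod (a * z + b) + cmod z"
      using norm_triangle_ineq4[of "a * z + b" "a * z"] u by (simp add: norm_mult)
    moreover have "0 \<le> R * D" using R0 D by simp
    ultimately show ?thesis using u D DD RD RD1 RD0 by (auto simp: algebra_simps)
  next
    case False
    then have c1: "cmod c \<ge> 1" using O cmod_ge_1 by blast
    have "a * of_real N = c * X + cnj w"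
    proof -
      have "c * X = c * (a * z + b) * cnj w + a * (c * cnj c * (of_real t)\<^sup>2)"
        by (simp add: Xe algebra_simps)
      also have "c * (a * z + b) = a * w - 1" using det by (simp add: w_def algebra_simps)
      finally have "c * X + cnj w = a * (w * cnj w + c * cnj c * (of_real t)\<^sup>2)"
        by (simp add: algebra_simps)
      also have "\<dots> = a * of_real N"
        unfolding N(1) of_real_add of_real_mult complex_norm_square by simp
      finally show ?thesis ..
    qed
    then have "cmod a * N \<le> cmod c * cmod X + cmod w"
      using norm_triangle_ineq[of "c * X" "cnj w"] N(3)
      by (metis abs_of_pos complex_mod_cnj norm_mult norm_of_real)
    also have "\<dots> \<le> D * (R * N) + D * N"
    proof (rule add_mono)
      show "cmod c * cmod X \<le> D * (R * N)" using cD X D by (intro mult_mono) auto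
      have "1 * t\<^sup>2 \<le> (cmod c)\<^sup>2 * t\<^sup>2" using c1 by (intro mult_right_mono) auto
      then have "t\<^sup>2 \<le> N" unfolding N(1) using zero_le_power2[of "cmod w"] by linarith
      have "(cmod w)\<^sup>2 \<le> N" by (simp add: N(1))
      then have "(cmod w)\<^sup>2 * t\<^sup>2 \<le> N * N" using \<open>t\<^sup>2 \<le> N\<close> N by (intro mult_mono) auto
      then have "(cmod w * t)\<^sup>2 \<le> N\<^sup>2" by (simp add: power_mult_distrib power2_eq_square[of N])
      then have "cmod w * t \<le> N" using N by (meson power2_le_imp_le less_imp_le)
      then have "cmod w \<le> inverse t * N" using t by (simp add: field_simps)
      also have "\<dots> \<le> D * N" using D N by (intro mult_right_mono) auto
      finally show "cmod w \<le> D * N" .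
    qed
    also have "\<dots> = (R * D + D) * N" by (simp add: algebra_simps)
    finally have aD: "cmod a \<le> R * D + D" using N(3) by simp
    have "cmod e = cmod (w - c * z)" by (simp add: w_def)
    also have "\<dots> \<le> cmod w + cmod c * cmod z" using norm_triangle_ineq4[of w "c * z"] by (simp add: norm_mult)
    also have "cmod w \<le> 1"
    proof -
      have "(cmod w)\<^sup>2 + (cmod c * t)\<^sup>2 \<le> 1" using N by (simp add: power_mult_distrib)
      then have "(cmod w)\<^sup>2 \<le> 1" using zero_le_power2[of "cmod c * t"] by linarith
      then show ?thesis by (simp add: power_le_one_iff)
    qed
    also have "1 + cmod c * cmod z \<le> cmod c * (1 + D)"
      using c1 D mult_left_mono[OF D(2), of "cmod c"] by (simp add: algebra_simps)
    also have "\<dots> \<le> cmod c * (2 * D)" using D by (intro mult_left_mono) auto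
    finally have e': "cmod e \<le> cmod c * (2 * D)" by simp
    have "a * e - 1 = b * c" using det by (simp add: algebra_simps)
    then have "cmod b * cmod c = cmod (a * e - 1)" by (simp only: norm_mult)
    also have "\<dots> \<le> cmod a * cmod e + 1" using norm_triangle_ineq4[of "a * e" 1] by (simp add: norm_mult)
    also have "\<dots> \<le> (R * D + D) * (cmod c * (2 * D)) + cmod c"
      using aD e' c1 R0 D by (intro add_mono mult_mono) auto
    also have "\<dots> = ((R * D + D) * (2 * D) + 1) * cmod c" by (simp add: algebra_simps)
    finally have "cmod b \<le> (R * D + D) * (2 * D) + 1"
      using c1 by (meson mult_right_le_imp_le less_le_trans zero_less_one)
    also have "\<dots> \<le> (2 * R + 3) * D\<^sup>2"
      using one_le_power[OF D(1), of 2] by (simp add: algebra_simps power2_eq_square)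
    finally show ?thesis using aD by simp
  qed
  moreover have "R * D + D \<le> (2 * R + 3) * D\<^sup>2" "D \<le> (2 * R + 3) * D\<^sup>2" "2 * D\<^sup>2 \<le> (2 * R + 3) * D\<^sup>2"
    using RD RD0 DD D by (simp_all add: algebra_simps)
  ultimately show ?thesis
    unfolding height_le_iff forall_2 D_def[symmetric] abce[symmetric] using cD eD by linarith
qed

subsection \<open>Reduction to the cusp polygon\<close>

lemma exists_closest_translate:
  assumes "d > 0"
  obtains v where "v \<in> quad_ints d" "\<And>g. g \<in> quad_ints d \<Longrightarrow> cmod (z + v) \<le> cmod (z + v + g)"
proof -
  define S where "S = {v \<in> quad_ints d. cmod (z + v) \<le> cmod z}"
  have "cmod v \<le> 2 * cmod z" if "v \<in> S" for v
    using that norm_triangle_ineq4[of "z + v" z] by (simp add: S_def)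
  then have "S \<subseteq> {v \<in> quad_ints d. cmod v \<le> 2 * cmod z}" by (auto simp: S_def)
  then have "finite S" by (rule finite_subset) (rule finite_quad_ints_cball[OF assms])
  have "0 \<in> S" by (simp add: S_def)
  then obtain v where v: "v \<in> S" "\<And>v'. v' \<in> S \<Longrightarrow> cmod (z + v) \<le> cmod (z + v')"
    using arg_min_if_finite(1)[of S "\<lambda>v. cmod (z + v)"] arg_min_least[of S _ "\<lambda>v. cmod (z + v)"]
      \<open>finite S\<close> by blast
  have "cmod (z + v) \<le> cmod (z + v + g)" if "g \<in> quad_ints d" for g
  proof (cases "cmod (z + (v + g)) \<le> cmod z")
    case True
    then have "v + g \<in> S" using v(1) that by (auto simp: S_def)
    then show ?thesis using v(2) by (metis add.assoc)
  next
    case False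
    then show ?thesis using v(1) by (simp add: S_def add.assoc)
  qed
  then show thesis using v(1) by (intro that[of v]) (auto simp: S_def)
qed

lemma closest_half_plane:
  assumes "cmod w \<le> cmod (w + g)"
  shows "0 \<le> 2 * (Re w * Re g + Im w * Im g) + (Re g)\<^sup>2 + (Im g)\<^sup>2"
proof -
  have "(cmod w)\<^sup>2 \<le> (cmod (w + g))\<^sup>2" using assms by (simp add: power_mono)
  then show ?thesis unfolding cmod_power2 by (simp add: power2_eq_square algebra_simps)
qed

lemma cusp_polygon_1_reduction:
  obtains u v where "u \<in> quad_ints 1" "v \<in> quad_ints 1" "cmod u = 1"
    "u * (u * z + v) \<in> cusp_polygon 1"
proof -
  obtain v where v: "v \<in> quad_ints 1" "\<And>g. g \<in> quad_ints 1 \<Longrightarrow> cmod (z + v) \<le> cmod (z + v + g)"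
    using exists_closest_translate[of 1 z] by auto
  have I: "\<i> \<in> quad_ints 1" using quad_ints_omega[of 1] by (simp add: omega_def)
  define w where "w = z + v"
  have half: "0 \<le> 2 * (Re w * Re g + Im w * Im g) + (Re g)\<^sup>2 + (Im g)\<^sup>2" if "g \<in> quad_ints 1" for g
    using closest_half_plane[OF v(2)[OF that]] unfolding w_def .
  have b: "\<bar>Re w\<bar> \<le> 1 / 2" "\<bar>Im w\<bar> \<le> 1 / 2"
    using half[OF quad_ints_1] half[OF quad_ints_uminus[OF quad_ints_1]] half[OF I]
      half[OF quad_ints_uminus[OF I]] by auto
  show thesis
  proof (cases "Im w \<ge> 0")
    case True
    then show thesis using that[of 1 v] v(1) b by (simp add: cusp_polygon_def w_def)
  next
    case False
    have "\<i> * (\<i> * z + \<i> * v) = - w" by (simp add: w_def algebra_simps)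
    then show thesis using that[of "\<i>" "\<i> * v"] v(1) I b False
      by (simp add: cusp_polygon_def quad_ints_mult)
  qed
qed

text \<open>The translate of \<open>z\<close> closest to \<open>0\<close> lies in the Voronoi hexagon of \<open>\<int>[\<omega>]\<close>, of which
  \<open>cusp_polygon 3\<close> is the third with argument between \<open>-\<pi>/6\<close> and \<open>\<pi>/2\<close>.\<close>

lemma cusp_polygon_3_reduction:
  obtains u v where "u \<in> quad_ints 3" "v \<in> quad_ints 3" "cmod u = 1"
    "u * (u * z + v) \<in> cusp_polygon 3"
proof -
  obtain v where v: "v \<in> quad_ints 3" "\<And>g. g \<in> quad_ints 3 \<Longrightarrow> cmod (z + v) \<le> cmod (z + v + g)"
    using exists_closest_translate[of 3 z] by auto
  define r where "r = sqrt (3::real)"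
  have r: "r > 0" "r * r = 3" by (simp_all add: r_def)
  define \<omega> where "\<omega> = omega 3"
  have \<omega>: "Re \<omega> = - 1 / 2" "Im \<omega> = r / 2" "\<omega> \<in> quad_ints 3" "cnj \<omega> \<in> quad_ints 3"
    unfolding \<omega>_def by (simp_all add: quad_ints_cnj) (simp_all add: omega_def r_def)
  have rr: "r\<^sup>2 = 3" using r by (simp add: power2_eq_square)
  have \<omega>1: "cmod \<omega> = 1" unfolding cmod_def \<omega>(1,2) by (simp add: power_divide rr)
  have \<omega>2: "\<omega> * \<omega> = cnj \<omega>" "cnj \<omega> * cnj \<omega> = \<omega>"
    using r(2) by (simp_all add: complex_eq_iff \<omega>(1,2))
  define w where "w = z + v"
  define s where "s = r * Im w"
  have half: "0 \<le> 2 * (Re w * Re g + Im w * Im g) + (Re g)\<^sup>2 + (Im g)\<^sup>2" if "g \<in> quad_ints 3" for g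
    using closest_half_plane[OF v(2)[OF that]] unfolding w_def .
  have "0 \<le> 2 * Re w + 1" "0 \<le> - 2 * Re w + 1"
    using half[OF quad_ints_1] half[OF quad_ints_uminus[OF quad_ints_1]] by simp_all
  moreover have "0 \<le> - Re w + s + 1" "0 \<le> Re w - s + 1"
    using half[OF \<omega>(3)] half[OF quad_ints_uminus[OF \<omega>(3)]]
    by (simp_all add: \<omega> rr power_divide s_def algebra_simps)
  moreover have "0 \<le> - Re w - s + 1" "0 \<le> Re w + s + 1"
    using half[OF \<omega>(4)] half[OF quad_ints_uminus[OF \<omega>(4)]]
    by (simp_all add: \<omega> rr power_divide s_def algebra_simps)
  ultimately have hex: "\<bar>Re w\<bar> \<le> 1 / 2" "\<bar>Re w + s\<bar> \<le> 1" "\<bar>Re w - s\<bar> \<le> 1"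
    by linarith+
  have sector: "x \<in> cusp_polygon 3"
    if "0 \<le> Re x" "- Re x \<le> r * Im x" "Re x \<le> 1 / 2" "Re x + r * Im x \<le> 1" for x
  proof -
    have "- Re x / r \<le> Im x" "Im x \<le> (1 - Re x) / r"
      using that r by (simp_all add: field_simps)
    moreover have "Re x / r \<le> Im x \<or> Im x \<le> Re x / r" by linarith
    ultimately show ?thesis using that by (auto simp: cusp_polygon_def r_def)
  qed
  consider "0 \<le> Re w" "- Re w \<le> s" | "s \<le> Re w" "Re w + s \<le> 0" | "Re w \<le> 0" "Re w \<le> s"
    by linarith
  then show thesis
  proof cases
    case 1
    then have "1 * (1 * z + v) \<in> cusp_polygon 3"
      using sector[of w] hex by (simp add: s_def w_def)
    then show thesis using that[of 1 v] v(1) by simp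
  next
    case 2
    have Re: "Re (\<omega> * w) = (- Re w - s) / 2" and Im: "Im (\<omega> * w) = (r * Re w - Im w) / 2"
      by (simp_all add: \<omega>(1,2) s_def field_simps)
    have "r * Im (\<omega> * w) = (3 * Re w - s) / 2"
      unfolding Im s_def r(2)[symmetric] by (simp add: algebra_simps)
    with Re have "\<omega> * w \<in> cusp_polygon 3" using sector[of "\<omega> * w"] hex 2 by argo
    moreover have "(cnj \<omega> * cnj \<omega>) * w = cnj \<omega> * (cnj \<omega> * z + cnj \<omega> * v)"
      by (simp add: w_def algebra_simps)
    then have "\<omega> * w = cnj \<omega> * (cnj \<omega> * z + cnj \<omega> * v)" unfolding \<omega>2(2) .
    ultimately show thesis using that[of "cnj \<omega>" "cnj \<omega> * v"] v(1) \<omega> \<omega>1 by (simp add: quad_ints_mult)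
  next
    case 3
    have Re: "Re (cnj \<omega> * w) = (s - Re w) / 2" and Im: "Im (cnj \<omega> * w) = (- r * Re w - Im w) / 2"
      by (simp_all add: \<omega>(1,2) s_def field_simps)
    have "r * Im (cnj \<omega> * w) = (- 3 * Re w - s) / 2"
      unfolding Im s_def r(2)[symmetric] by (simp add: algebra_simps)
    with Re have "cnj \<omega> * w \<in> cusp_polygon 3" using sector[of "cnj \<omega> * w"] hex 3 by argo
    moreover have "(\<omega> * \<omega>) * w = \<omega> * (\<omega> * z + \<omega> * v)"
      by (simp add: w_def algebra_simps)
    then have "cnj \<omega> * w = \<omega> * (\<omega> * z + \<omega> * v)" unfolding \<omega>2(1) .
    ultimately show thesis using that[of "\<omega>" "\<omega> * v"] v(1) \<omega> \<omega>1 by (simp add: quad_ints_mult)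
  qed
qed

lemma cusp_polygon_reduction:
  assumes "d > 0"
  obtains u v where "u \<in> quad_ints d" "v \<in> quad_ints d" "cmod u = 1"
    "u * (u * z + v) \<in> cusp_polygon d"
proof (cases "d = 1 \<or> d = 3")
  case True
  then show thesis using cusp_polygon_1_reduction cusp_polygon_3_reduction that by metis
next
  case False
  define h where "h = Im (omega d)"
  have h: "h > 0" using assms by (simp add: h_def omega_def)
  define n where "n = - \<lfloor>Im z / h\<rfloor>"
  define m where "m = - \<lfloor>Re (z + of_int n * omega d)\<rfloor>"
  define v where "v = of_int m + of_int n * omega d"
  have "v \<in> quad_ints d" unfolding v_def quad_ints_def by blast
  have "of_int \<lfloor>Im z / h\<rfloor> * h \<le> Im z" "Im z \<le> (of_int \<lfloor>Im z / h\<rfloor> + 1) * h"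
    using h floor_divide_lower[of h "Im z"] floor_divide_upper[of h "Im z"] by auto
  then have "0 \<le> Im (z + v)" "Im (z + v) \<le> h"
    by (simp_all add: v_def n_def h_def algebra_simps)
  moreover have "Re (z + v) = Re (z + of_int n * omega d) - of_int \<lfloor>Re (z + of_int n * omega d)\<rfloor>"
    by (simp add: v_def m_def)
  then have "0 \<le> Re (z + v)" "Re (z + v) \<le> 1" by linarith+
  moreover have "h = (if d mod 4 = 3 then sqrt (real d) / 2 else sqrt (real d))"
    by (simp add: h_def omega_def)
  ultimately have "z + v \<in> cusp_polygon d" using False by (auto simp: cusp_polygon_def split: if_splits)
  then show thesis using that[of 1 v] \<open>v \<in> quad_ints d\<close> by simp
qed

lemma cusp_polygon_bound:
  assumes "z \<in> cusp_polygon d" "d > 0"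
  shows "cmod z \<le> 2 * sqrt (real d)"
proof -
  have d1: "1 \<le> sqrt (real d)" using assms by simp
  have "\<bar>Re z\<bar> \<le> 1 \<and> \<bar>Im z\<bar> \<le> sqrt (real d)"
  proof (cases "d = 3")
    case True
    define r where "r = sqrt (3::real)"
    have r: "r \<ge> 1" by (simp add: r_def)
    consider "0 \<le> Re z" "Re z / r \<le> Im z" "Im z \<le> (1 - Re z) / r"
      | "0 \<le> Re z" "Re z \<le> 1 / 2" "- Re z / r \<le> Im z" "Im z \<le> Re z / r"
      using assms True unfolding cusp_polygon_def r_def by auto
    then have "\<bar>Re z\<bar> \<le> 1 \<and> \<bar>r * Im z\<bar> \<le> 1"
    proof cases
      case 1
      then have "Re z \<le> r * Im z" "r * Im z \<le> 1 - Re z" using r by (simp_all add: field_simps)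
      then show ?thesis using 1(1) by linarith
    next
      case 2
      then have "- Re z \<le> r * Im z" "r * Im z \<le> Re z" using r by (simp_all add: field_simps)
      then show ?thesis using 2(1,2) by linarith
    qed
    moreover have "1 * \<bar>Im z\<bar> \<le> r * \<bar>Im z\<bar>" using r by (intro mult_right_mono) auto
    moreover have "\<bar>r * Im z\<bar> = r * \<bar>Im z\<bar>" using r by (simp add: abs_mult)
    ultimately show ?thesis using d1 by linarith
  next
    case False
    then show ?thesis using assms d1 by (auto simp: cusp_polygon_def split: if_splits)
  qed
  then show ?thesis using cmod_le[of z] d1 by linarith
qed

lemma row_norm_mult: "row_norm (k * c) (k * e) p = (cmod k)\<^sup>2 * row_norm c e p"
proof -
  obtain z t where p: "p = (z, t)" by fastforce
  have "k * c * z + k * e = k * (c * z + e)" by (simp add: algebra_simps)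
  then have "cmod (k * c * z + k * e) = cmod k * cmod (c * z + e)" by (simp only: norm_mult)
  then show ?thesis
    unfolding p row_norm_def prod.case norm_mult[of k c] by (simp add: power_mult_distrib algebra_simps)
qed

lemma exists_reduction:
  assumes "d > 0" "t > 0"
  obtains A where "A \<in> carrier (SL2 (quad_ints d))" "SL2_act A (z, t) \<in> fund_domain d"
    "SL2_height A \<le> (4 * sqrt (real d) + 3) * (depth (z, t))\<^sup>2"
proof -
  obtain c e where ce: "unimodular_row d c e" "row_norm c e (z, t) \<le> 1"
    "\<And>c' e'. unimodular_row d c' e' \<Longrightarrow> row_norm c e (z, t) \<le> row_norm c' e' (z, t)"
    using exists_minimal_row[OF assms] by metis
  obtain B where B: "B \<in> carrier (SL2 (quad_ints d))" "B $ 2 $ 1 = c" "B $ 2 $ 2 = e"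
    using unimodular_row_completion[OF ce(1)] by metis
  obtain z' t' where B': "SL2_act B (z, t) = (z', t')" by fastforce
  obtain u v where u: "u \<in> quad_ints d" "v \<in> quad_ints d" "cmod u = 1"
    and poly: "u * (u * z' + v) \<in> cusp_polygon d"
    using cusp_polygon_reduction[OF assms(1)] by metis
  define T where "T = mat2 u v 0 (cnj u)"
  have "u * cnj u = 1" using u(3) by (metis complex_norm_square of_real_1 power_one)
  then have T: "T \<in> carrier (SL2 (quad_ints d))"
    unfolding T_def using u by (intro mat2_carrier_SL2) auto
  define A where "A = T ** B"
  have A: "A \<in> carrier (SL2 (quad_ints d))" unfolding A_def using T B(1) by (rule SL2_mult_closed)
  have "A $ 2 $ 1 = cnj u * c" "A $ 2 $ 2 = cnj u * e"
    by (simp_all add: A_def T_def matrix_mult_nth_2 B)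
  then have den: "act_den A (z, t) = row_norm c e (z, t)"
    by (simp add: row_norm_mult u(3))
  have "det B = 1" using B(1) by (simp add: carrier_SL2_iff)
  then have "SL2_act A (z, t) = SL2_act T (z', t')"
    unfolding A_def using assms(2) B' by (simp add: SL2_act_mult)
  also have "\<dots> = (u * (u * z' + v), t')"
    by (simp add: T_def SL2_act_eq act_num_def row_norm_def u(3))
  finally have fst: "fst (SL2_act A (z, t)) \<in> cusp_polygon d" using poly by simp
  have "SL2_act A (z, t) \<in> floor_region d"
    using SL2_act_in_floor_region[OF A assms(2)] ce(3) den by simp
  then have "SL2_act A (z, t) \<in> fund_domain d" using fst by (auto simp: fund_domain_def)
  moreover have "SL2_height A \<le> (2 * (2 * sqrt (real d)) + 3) * (depth (z, t))\<^sup>2"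
    using height_bound[OF A assms(2) _ cusp_polygon_bound[OF fst assms(1)]] ce(2) den by simp
  ultimately show thesis using that A by simp
qed

subsection \<open>Intricacy\<close>

lemma height_square_Nats:
  assumes "A \<in> carrier (SL2 (quad_ints d))" shows "(SL2_height A)\<^sup>2 \<in> \<nat>" "SL2_height A \<ge> 0"
proof -
  have eq: "{cmod (A $ i $ j) | i j. True} = (\<lambda>(i, j). cmod (A $ i $ j)) ` UNIV" by auto
  have "SL2_height A \<in> {cmod (A $ i $ j) | i j. True}"
    unfolding SL2_height_def eq by (rule Max_in) auto
  then obtain i j where ij: "SL2_height A = cmod (A $ i $ j)" by blast
  show "(SL2_height A)\<^sup>2 \<in> \<nat>" unfolding ij
    using assms by (intro cmod_square_Nats[of _ d]) (simp add: carrier_SL2_iff)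
  show "SL2_height A \<ge> 0" unfolding ij by simp
qed

lemma intricacy_attained:
  assumes "A \<in> carrier (SL2 (quad_ints d))" "SL2_act A p \<in> fund_domain d"
  shows "intricacy d p \<le> SL2_height A"
    and "\<exists>B \<in> carrier (SL2 (quad_ints d)). SL2_act B p \<in> fund_domain d \<and> intricacy d p = SL2_height B"
proof -
  define S where "S = {B \<in> carrier (SL2 (quad_ints d)). SL2_act B p \<in> fund_domain d}"
  have "\<exists>\<sigma>. SL2_height B = PSL2_height \<sigma> \<and> \<sigma> \<in> (\<lambda>A. {A, - A}) ` carrier (SL2 (quad_ints d)) \<and>
      PSL2_act \<sigma> p \<in> fund_domain d" if "B \<in> S" for B
    using that by (intro exI[of _ "{B, - B}"]) (auto simp: S_def PSL2_act_coset PSL2_height_coset)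
  then have H: "{PSL2_height \<sigma> | \<sigma>. \<sigma> \<in> carrier (Bianchi d) \<and> PSL2_act \<sigma> p \<in> fund_domain d} = SL2_height ` S"
    unfolding Bianchi_def carrier_PSL2 by (auto simp: S_def PSL2_act_coset PSL2_height_coset)
  define f where "f = (\<lambda>B. nat \<lfloor>(SL2_height B)\<^sup>2\<rfloor>)"
  obtain B where B: "B \<in> S" "\<And>B'. B' \<in> S \<Longrightarrow> f B \<le> f B'"
    using ex_has_least_nat[of "\<lambda>B. B \<in> S" A f] assms by (auto simp: S_def)
  have f: "real (f B') = (SL2_height B')\<^sup>2" if "B' \<in> S" for B'
  proof -
    have "B' \<in> carrier (SL2 (quad_ints d))" using that by (simp add: S_def)
    then obtain m where "(SL2_height B')\<^sup>2 = real m"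
      using height_square_Nats(1) Nats_cases by blast
    then show ?thesis by (simp add: f_def)
  qed
  have least: "SL2_height B \<le> SL2_height B'" if "B' \<in> S" for B'
  proof (rule power2_le_imp_le)
    show "(SL2_height B)\<^sup>2 \<le> (SL2_height B')\<^sup>2" using B(2)[OF that] f[OF that] f[OF B(1)] by linarith
    show "0 \<le> SL2_height B'" using that height_square_Nats(2) by (auto simp: S_def)
  qed
  have "intricacy d p = SL2_height B"
    unfolding intricacy_def H using B(1) least by (intro Least_equality) auto
  then show "intricacy d p \<le> SL2_height A"
    "\<exists>B \<in> carrier (SL2 (quad_ints d)). SL2_act B p \<in> fund_domain d \<and> intricacy d p = SL2_height B"
    using B(1) least[of A] assms by (auto simp: S_def)
qed

lemma fund_domain_high_stabilizer:
  assumes A: "A \<in> carrier (SL2 (quad_ints d))" and t: "t > 1" and d: "d > 0"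
    and F: "SL2_act A (0, t) \<in> fund_domain d"
  shows "cmod (A $ 1 $ 1) = 1" "cmod (A $ 1 $ 2) \<le> 2 * sqrt (real d)"
proof -
  define a b c e where "a = A$1$1" "b = A$1$2" "c = A$2$1" "e = A$2$2"
  note abce = this
  have O: "a \<in> quad_ints d" "b \<in> quad_ints d" "c \<in> quad_ints d" "e \<in> quad_ints d"
    and dA: "det A = 1" and det: "a * e - b * c = 1"
    using A by (simp_all add: abce carrier_SL2_iff det_2)
  have "unimodular_row d (- c) a"
    unfolding unimodular_row_def using O det
    by (intro conjI bexI[of _ b] bexI[of _ e]) (auto simp: algebra_simps)
  then have ge: "row_norm (- c) a (SL2_act A (0, t)) \<ge> 1"
    using F by (auto simp: fund_domain_def floor_region_iff)
  have "- c * a + a * c = 0" "- c * b + a * e = 1" using det by (simp_all add: algebra_simps)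
  then have "row_norm (- c) a (SL2_act A (0, t)) * row_norm c e (0, t) = row_norm 0 1 (0, t)"
    using row_norm_SL2_act[OF dA, of t "- c" a 0] t unfolding abce[symmetric] by simp
  also have "\<dots> = 1" by (simp add: row_norm_def)
  finally have "row_norm c e (0, t) \<le> 1"
    using ge mult_right_mono[OF ge row_norm_nonneg[of c e "(0, t)"]] by simp
  then have "cmod c \<le> inverse t" using row_norm_le_1_bounds(1) t by force
  also have "\<dots> < 1" using t by (simp add: field_simps)
  finally have c0: "c = 0" using cmod_ge_1[OF O(3)] by fastforce
  then have u: "cmod a = 1" "cmod e = 1" using cmod_unit[OF O(1,4)] det by auto
  then show "cmod (A $ 1 $ 1) = 1" by (simp add: abce)
  have "fst (SL2_act A (0, t)) = b * cnj e"
    by (simp add: SL2_act_eq act_num_def abce[symmetric] c0 row_norm_def u)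
  moreover have "fst (SL2_act A (0, t)) \<in> cusp_polygon d" using F by (auto simp: fund_domain_def)
  ultimately have "cmod (b * cnj e) \<le> 2 * sqrt (real d)" using cusp_polygon_bound d by metis
  then show "cmod (A $ 1 $ 2) \<le> 2 * sqrt (real d)" using u by (simp add: norm_mult abce)
qed

lemma large_intricacy:
  assumes "n \<ge> 2" "d > 0"
  obtains p where "p \<in> upper_half_space" "depth p \<le> 2 * real n" "depth p \<ge> 1"
    "intricacy d p \<ge> (real n)\<^sup>2 - 1 - 2 * sqrt (real d) * real n"
proof -
  define N where "N = complex_of_nat n"
  define M where "M = mat2 N (1 - N\<^sup>2) (- 1) N"
  define p where "p = SL2_act M (0, real n)"
  have NO: "N \<in> quad_ints d" by (simp add: N_def)
  have M: "M \<in> carrier (SL2 (quad_ints d))"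
    unfolding M_def using NO by (intro mat2_carrier_SL2) (auto simp: power2_eq_square)
  have den: "row_norm (- 1) N (0, real n) = 2 * (real n)\<^sup>2"
    by (simp add: row_norm_def N_def)
  have p: "p = ((1 - 2 * N\<^sup>2) / (2 * N), 1 / (2 * real n))"
    using assms(1) den unfolding p_def M_def SL2_act_eq
    by (simp add: act_num_def N_def power2_eq_square field_simps)
  have U: "p \<in> upper_half_space" using assms(1) by (simp add: p upper_half_space_def)
  have "(1 - 2 * N\<^sup>2) / (2 * N) = complex_of_real ((1 - 2 * (real n)\<^sup>2) / (2 * real n))"
    by (simp add: N_def)
  then have "cmod ((1 - 2 * N\<^sup>2) / (2 * N)) = \<bar>(1 - 2 * (real n)\<^sup>2) / (2 * real n)\<bar>"
    by (simp only: norm_of_real)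
  also have "\<dots> \<le> 2 * real n"
  proof -
    have "(real n)\<^sup>2 \<ge> 1" using assms(1) by simp
    then have "\<bar>1 - 2 * (real n)\<^sup>2\<bar> \<le> 2 * real n * (2 * real n)"
      by (simp add: power2_eq_square)
    then show ?thesis using assms(1) by (simp add: abs_divide divide_le_eq)
  qed
  finally have "depth p \<le> 2 * real n" using assms(1) by (simp add: p depth_def)
  moreover have "depth p \<ge> 1" by (simp add: p depth_ge)
  moreover have "intricacy d p \<ge> (real n)\<^sup>2 - 1 - 2 * sqrt (real d) * real n"
  proof -
    obtain z t where zt: "p = (z, t)" by fastforce
    then have "t > 0" using U by (simp add: upper_half_space_def)
    then obtain A0 where "A0 \<in> carrier (SL2 (quad_ints d))" "SL2_act A0 p \<in> fund_domain d"
      using exists_reduction[OF assms(2)] unfolding zt by metis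
    then obtain A where A: "A \<in> carrier (SL2 (quad_ints d))" "SL2_act A p \<in> fund_domain d"
      "intricacy d p = SL2_height A" using intricacy_attained(2) by blast
    define T where "T = A ** M"
    have T: "T \<in> carrier (SL2 (quad_ints d))" unfolding T_def using A(1) M by (rule SL2_mult_closed)
    have "det M = 1" using M by (simp add: carrier_SL2_iff)
    then have "SL2_act T (0, real n) \<in> fund_domain d"
      using A(2) assms(1) by (simp add: T_def SL2_act_mult p_def)
    note stab = fund_domain_high_stabilizer[OF T _ assms(2) this]
    have T12: "cmod (T $ 1 $ 1) = 1" "cmod (T $ 1 $ 2) \<le> 2 * sqrt (real d)"
      using stab assms(1) by auto
    have "T $ 1 $ 1 * (N\<^sup>2 - 1) = A $ 1 $ 2 - T $ 1 $ 2 * N"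
      by (simp add: T_def matrix_mult_nth_2 M_def algebra_simps power2_eq_square)
    then have "cmod (T $ 1 $ 1) * cmod (N\<^sup>2 - 1) \<le> cmod (A $ 1 $ 2) + cmod (T $ 1 $ 2) * real n"
      using norm_triangle_ineq4[of "A $ 1 $ 2" "T $ 1 $ 2 * N"]
      by (metis N_def norm_mult norm_of_nat)
    moreover have "N\<^sup>2 - 1 = complex_of_real ((real n)\<^sup>2 - 1)" by (simp add: N_def)
    then have "cmod (N\<^sup>2 - 1) = \<bar>(real n)\<^sup>2 - 1\<bar>" by (simp only: norm_of_real)
    moreover have "cmod (T $ 1 $ 2) * real n \<le> 2 * sqrt (real d) * real n"
      using T12 by (intro mult_right_mono) auto
    moreover have "cmod (A $ 1 $ 2) \<le> SL2_height A" using height_le_iff by blast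
    ultimately show ?thesis using T12 A(3) by simp
  qed
  ultimately show thesis using that U by blast
qed

theorem theorem3p1:
  shows "\<exists>C > (0::real). \<exists>c :: nat \<Rightarrow> real. \<forall>d :: nat. d > 0 \<and> squarefree d \<longrightarrow>
     c d > 0 \<and> c d \<le> C * real d \<and>
     (\<forall>p \<in> upper_half_space. intricacy d p \<le> c d * (depth p)\<^sup>2) \<and>
     (\<forall>e < (2::real). \<forall>k > (0::real). \<exists>p \<in> upper_half_space. intricacy d p > k * depth p powr e)"
proof (intro exI[of _ 7] exI[of _ "\<lambda>d. 4 * sqrt (real d) + 3"] conjI allI impI ballI)
  show "(0::real) < 7" by simp
  fix d :: nat assume "d > 0 \<and> squarefree d"
  then have d: "d > 0" by simp
  show "0 < 4 * sqrt (real d) + 3" by (simp add: add_nonneg_pos)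
  have "sqrt (real d) \<le> real d"
    using d by (intro real_le_lsqrt) (auto simp: self_le_power)
  then show "4 * sqrt (real d) + 3 \<le> 7 * real d" using d by simp
  show "intricacy d p \<le> (4 * sqrt (real d) + 3) * (depth p)\<^sup>2" if "p \<in> upper_half_space" for p
  proof -
    obtain z t where p: "p = (z, t)" by fastforce
    then have "t > 0" using that by (simp add: upper_half_space_def)
    then show ?thesis
      using exists_reduction[OF d] intricacy_attained(1) unfolding p by (metis order_trans)
  qed
  fix e k :: real assume e: "e < 2" and k: "k > 0"
  define e' where "e' = max e 0"
  have "0 \<le> e'" "e' < 2" "e \<le> e'" using e by (auto simp: e'_def)
  have "eventually (\<lambda>n::nat. k * (2 * real n) powr e' < (real n)\<^sup>2 - 1 - 2 * sqrt (real d) * real n) at_top"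
    using \<open>e' < 2\<close> by real_asymp
  then obtain n where n: "n \<ge> 2" "k * (2 * real n) powr e' < (real n)\<^sup>2 - 1 - 2 * sqrt (real d) * real n"
    using eventually_happens'[OF sequentially_bot eventually_conj[OF eventually_ge_at_top[of 2]]] by blast
  obtain p where p: "p \<in> upper_half_space" "depth p \<le> 2 * real n" "depth p \<ge> 1"
    "intricacy d p \<ge> (real n)\<^sup>2 - 1 - 2 * sqrt (real d) * real n"
    using large_intricacy[OF n(1) d] by blast
  have "depth p powr e \<le> depth p powr e'" using p \<open>e \<le> e'\<close> by (intro powr_mono) auto
  also have "\<dots> \<le> (2 * real n) powr e'" using p \<open>0 \<le> e'\<close> by (intro powr_mono2) auto
  finally have "k * depth p powr e \<le> k * (2 * real n) powr e'" using k by simp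
  then show "\<exists>p \<in> upper_half_space. intricacy d p > k * depth p powr e"
    using n(2) p by (intro bexI[of _ p]) auto
qed

end
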